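(* Let $i>1$ be an integer and let $R$ be a $(2^i+2)$-potent ring, i.e. a ring such that $x^{2^i+2}=x$ for all $x\in R$. Then $R$ is commutative.
   Context: Rings are associative but are not assumed to have a unity. For an integer $n\geq 2$, a ring $R$ is called $n$-potent if $x^n=x$ for all $x\in R$. *)

theory Defs
  imports Main
begin

text \<open>
  The library's class \<^class>\<open>ring\<close> is exactly the class of associative rings that need not have
  a unity. Its power operator, however, requires a unity (for the exponent zero), so positive
  powers are defined here for arbitrary semigroups; the exponent zero is left unspecified.
\<close>

fun pos_power :: "'a::semigroup_mult \<Rightarrow> nat \<Rightarrow> 'a" where
  "pos_power x (Suc 0) = x"
| "pos_power x (Suc (Suc n)) = x * pos_power x (Suc n)"

lemma pos_power_eq_power:
  fixes x :: "'a::monoid_mult"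
  assumes "n \<ge> 1"
  shows "pos_power x n = x ^ n"
proof -
  have "pos_power x (Suc m) = x ^ Suc m" for m
    by (induction m) simp_all
  then show ?thesis
    using assms by (cases n) simp_all
qed

definition potent_ring :: "'a::ring itself \<Rightarrow> nat \<Rightarrow> bool" where
  "potent_ring R n \<longleftrightarrow> n \<ge> 2 \<and> (\<forall>x::'a. pos_power x n = x)"

definition commutative_ring :: "'a::ring itself \<Rightarrow> bool" where
  "commutative_ring R \<longleftrightarrow> (\<forall>x y::'a. x * y = y * x)"

end

theory Submission
  imports Defs
begin

text \<open>
  As the exponent is even, \<open>-x = x\<close>, so squaring is additive on commuting elements. With
  \<open>k = 2\<^sup>i\<close>, the element \<open>e = x ^ (k + 1)\<close> is an idempotent with \<open>e x = x e = x\<close>, and expanding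
  \<open>(x + e) ^ (k + 2) = (x ^ k + e) (x\<^sup>2 + e)\<close> yields \<open>x ^ k = x\<^sup>2\<close>, hence \<open>x\<^sup>4 = x\<close>.
  Then the ring is reduced, so its idempotents are central; among them are all \<open>x\<^sup>2 + x\<close>.
  Linearising, \<open>x y + y x\<close> is central; commuting it with \<open>x\<close> shows that \<open>x\<^sup>2\<close> is central,
  and therefore so is \<open>x\<close>.
\<close>

lemma pos_power_Suc:
  assumes "n \<ge> 1"
  shows "pos_power x (Suc n) = x * pos_power x n"
  using assms by (cases n) simp_all

lemma pos_power_add:
  assumes "m \<ge> 1" "n \<ge> 1"
  shows "pos_power x (m + n) = pos_power x m * pos_power x n"
  using assms(1)
  by (induction m rule: dec_induct) (use assms(2) in \<open>simp_all add: pos_power_Suc mult.assoc\<close>)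

lemma pos_power_commutes:
  assumes "n \<ge> 1"
  shows "pos_power x n * x = x * pos_power x n"
  using assms by (induction n rule: dec_induct) (simp_all add: pos_power_Suc mult.assoc)

lemma pos_power_two_power_Suc:
  "pos_power x (2 ^ Suc j) = pos_power x (2 ^ j) * pos_power x (2 ^ j)"
  by (simp add: mult_2 pos_power_add)

lemma pos_power_two_power_plus_2:
  "pos_power x (2 ^ j + 2) = pos_power x (2 ^ j) * (x * x)"
proof -
  have "pos_power x 2 = x * x"
    by (simp add: numeral_2_eq_2)
  then show ?thesis
    using pos_power_add[of "2 ^ j" 2 x] by simp
qed

text \<open>The sign disappears at the first squaring, so the exponent has to be at least 2;
  \<open>j = 0\<close> would give exponent 1.\<close>

lemma pos_power_two_power_uminus:
  fixes x :: "'a::ring"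
  assumes "j \<ge> 1"
  shows "pos_power (- x) (2 ^ j) = pos_power x (2 ^ j)"
  using assms
proof (induction j rule: dec_induct)
  case base
  show ?case by (simp add: numeral_2_eq_2)
next
  case (step j)
  then show ?case by (simp only: pos_power_two_power_Suc)
qed

text \<open>Since \<open>e\<close> is neutral for every power of \<open>x\<close>, the two cross
  terms in each squaring coincide and cancel in characteristic 2.\<close>

lemma pos_power_two_power_add_idempotent:
  fixes x e :: "'a::ring"
  assumes char2: "\<And>z::'a. z + z = 0"
    and "e * e = e" "x * e = x" "e * x = x"
  shows "pos_power (x + e) (2 ^ j) = pos_power x (2 ^ j) + e"
proof (induction j)
  case 0
  show ?case by simp
next
  case (Suc j)
  define q where "q = pos_power x (2 ^ j)"
  have units: "q * e = q \<and> e * q = q"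
    unfolding q_def
  proof (induction j)
    case 0
    show ?case using assms by simp
  next
    case (Suc j)
    then show ?case
      unfolding pos_power_two_power_Suc by (metis mult.assoc)
  qed
  have "pos_power (x + e) (2 ^ Suc j) = (q + e) * (q + e)"
    by (simp only: pos_power_two_power_Suc Suc.IH q_def)
  also have "\<dots> = q * q + (q + q) + e"
    using units assms(2) by (simp add: distrib_left distrib_right add.assoc)
  also have "\<dots> = q * q + e"
    by (simp add: char2)
  finally show ?case
    by (simp only: pos_power_two_power_Suc q_def)
qed

lemma potent_two_power_plus_2_imp_4_potent:
  fixes x :: "'a::ring"
  assumes char2: "\<And>z::'a. z + z = 0"
    and potent: "\<And>z::'a. pos_power z (2 ^ j + 2) = z"
  shows "x * x * (x * x) = x"
proof -
  define p where "p = pos_power x (2 ^ j)"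
  define e where "e = p * x"
  have comm: "p * x = x * p"
    unfolding p_def by (rule pos_power_commutes) simp
  have pxx: "p * (x * x) = x"
    using potent[of x] by (simp only: pos_power_two_power_plus_2 p_def)
  have ex: "e * x = x"
    by (simp add: e_def mult.assoc pxx)
  then have exx: "e * (x * x) = x * x"
    by (simp flip: mult.assoc)
  have xe: "x * e = x"
    by (metis comm e_def mult.assoc pxx)
  have ee: "e * e = e"
    by (metis e_def mult.assoc xe)
  \<comment> \<open>The power is written out instead of \<open>p\<close>, so that the induction
    varies its exponent while \<open>e\<close> stays fixed.\<close>
  have ep: "pos_power x (2 ^ j) * e = pos_power x (2 ^ j)"
  proof (induction j)
    case 0
    show ?case using xe by simp
  next
    case (Suc j)
    then show ?case
      unfolding pos_power_two_power_Suc by (simp add: mult.assoc)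
  qed
  have "x + e = pos_power (x + e) (2 ^ j) * ((x + e) * (x + e))"
    using potent[of "x + e"] by (simp only: pos_power_two_power_plus_2)
  also have "\<dots> = (p + e) * ((x + e) * (x + e))"
    using pos_power_two_power_add_idempotent[OF char2 ee xe ex] by (simp only: p_def)
  also have "(x + e) * (x + e) = x * x + (x + x) + e"
    by (simp add: distrib_left distrib_right ee xe ex add.assoc)
  also have "\<dots> = x * x + e"
    by (simp add: char2)
  also have "(p + e) * (x * x + e) = x + x * x + p + e"
    using ep exx by (simp add: distrib_left distrib_right ee pxx p_def[symmetric] add.assoc)
  \<comment> \<open>Both ends of the chain contain \<open>x\<close> and \<open>e\<close>, which
    cancel.\<close>
  finally have "x * x + p = 0"
    by (simp add: add.assoc)
  then have "p = x * x"
    by (metis add_left_cancel char2)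
  then show ?thesis
    using pxx by simp
qed

text \<open>Each one-sided product differs from \<open>e * x * e\<close> by an element of square
  zero.\<close>

lemma idempotent_central_if_reduced:
  fixes e x :: "'a::ring"
  assumes reduced: "\<And>z::'a. z * z = 0 \<Longrightarrow> z = 0"
    and idem: "e * e = e"
  shows "e * x = x * e"
proof -
  have idem': "e * (e * z) = e * z" for z
    by (simp add: idem flip: mult.assoc)
  have "e * x - e * x * e = 0"
    by (rule reduced) (simp add: algebra_simps idem idem')
  moreover have "x * e - e * x * e = 0"
    by (rule reduced) (simp add: algebra_simps idem idem')
  ultimately show ?thesis by simp
qed

lemma ring_4_potent_commute:
  fixes x y :: "'a::ring"
  assumes char2: "\<And>z::'a. z + z = 0"
    and potent: "\<And>z::'a. z * z * (z * z) = z"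
  shows "x * y = y * x"
proof -
  have reduced: "z = 0" if "z * z = 0" for z :: 'a
    using potent[of z] that by simp
  have eq_iff: "a = b \<longleftrightarrow> a + b = 0" for a b :: 'a
    by (metis add_right_cancel char2)
  have central: "(z * z + z) * w = w * (z * z + z)" for z w :: 'a
  proof (rule idempotent_central_if_reduced[OF reduced])
    \<comment> \<open>The cubes cancel in characteristic 2, and the fourth power is
      \<open>z\<close>.\<close>
    have "(z * z + z) * (z * z + z) = z * z * (z * z) + (z * z * z + z * z * z) + z * z"
      by (simp add: algebra_simps)
    then show "(z * z + z) * (z * z + z) = z * z + z"
      by (simp add: potent char2 add.commute)
  qed
  have "(x * y + y * x) * w = w * (x * y + y * x)" for w
  proof -
    have "x * y + y * x = ((x + y) * (x + y) + (x + y)) - (x * x + x) - (y * y + y)"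
      by (simp add: algebra_simps)
    then show ?thesis
      by (simp only: left_diff_distrib right_diff_distrib central)
  qed
  \<comment> \<open>With \<open>w = x\<close>, the term \<open>x * y * x\<close> occurs on both
    sides and cancels.\<close>
  from this[of x] have "x * x * y = y * (x * x)"
    by (simp add: algebra_simps)
  with central[of x y] show ?thesis
    by (simp add: algebra_simps)
qed

theorem corollary2p15:
  fixes i :: nat
  assumes "i > 1"
    and "potent_ring TYPE('a::ring) (2 ^ i + 2)"
  shows "commutative_ring TYPE('a)"
proof -
  have potent: "pos_power z (2 ^ i + 2) = z" for z :: 'a
    using assms(2) by (simp add: potent_ring_def)
  have char2: "z + z = 0" for z :: 'a
  proof -
    \<comment> \<open>Both factors, the \<open>2 ^ i\<close>-th power and the square, ignore the
      sign.\<close>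
    have "pos_power (- z) (2 ^ i + 2) = pos_power z (2 ^ i + 2)"
      using assms(1) by (simp only: pos_power_two_power_plus_2 pos_power_two_power_uminus
          less_imp_le minus_mult_minus)
    then have "- z = z"
      by (simp only: potent)
    then show ?thesis
      by (metis add.right_inverse)
  qed
  show ?thesis
    unfolding commutative_ring_def
    using ring_4_potent_commute[OF char2 potent_two_power_plus_2_imp_4_potent[OF char2 potent]]
    by blast
qed

end
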